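(* Consider a region with constant flow velocity $u\in\mathbb{R}^d$, maximum vehicle speed $V$, entrance location $x_0$ and exit location $x_f$. Let $L=1$ or $L=\|v\|^2+C$ with constant $C\ge0$. The vehicle motion described in the context (the maximum speed straight line motion for $L=1$; the constant velocity motion with the energy-optimal speed for $L=\|v\|^2+C$) solves, through its induced value function $\psi$ (where $\psi$ is finite), the Hamilton–Jacobi–Bellman equation $$\psi_t(x,t)+\max_{\|v\|\le V}\left\{\nabla\psi(x,t)^T(u+v)-L(x,v)\right\}=0$$ for $L=1$ and $L=\|v\|^2+C$ respectively. Moreover, among all the solutions of this equation, the motion gives the path with shortest time (for $L=1$), respectively minimum energy (for $L=\|v\|^2+C$). Thus, it is an optimal solution of the sub-problem in the region: minimize $\int_0^T L\,dt$ over $v,T$ subject to $\dot x=v+u$, $x(0)=x_0$, $x(T)=x_f$, $\max_{t\in[0,T]}\|v(t)\|\le V$.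
   Context: The vehicle obeys $\dot x=v+u$ with control $v$, $\|v\|\le V$. The terminal time $T$ is free. *Value functions.* $\psi(x,t)$ denotes the cost $\int_0^t L\,ds$ associated with going from $x_0$ to $x$ within time $t$, and is set to $+\infty$ if this is impossible. (i) $L=1$: the maximum speed straight line motion from $x_0$ to $x$ has constant $v$ with $\|v\|=V$, $v+u$ a positive multiple of $x-x_0$, and $$\|v+u\|=\frac{(x-x_0)^Tu}{\|x-x_0\|}+\sqrt{\left(\frac{(x-x_0)^Tu}{\|x-x_0\|}\right)^2+V^2-\|u\|^2}.$$ Its induced value function is $\psi(x,t)=\|x-x_0\|/\|v+u\|$ if $\|x-x_0\|/\|v+u\|\le t$, and $+\infty$ otherwise. (ii) $L=\|v\|^2+C$: the constant velocity straight line motion from $x_0$ to $x$ in time $t$ has $v=\frac{x-x_0}{t}-u$, and its induced value function is $$\psi(x,t)=(\|v\|^2+C)t=\frac{\|x-x_0\|^2}{t}-2(x-x_0)^Tu+(C+\|u\|^2)t$$ if $\|v\|\le V$, and $+\infty$ otherwise. The energy-optimal motion from $x_0$ to $x_f$ is the constant velocity motion with speed, writing $a=x_f-x_0$, $$\|v\|=\begin{cases}\left(C+2\|u\|^2-\sqrt{C+\|u\|^2}\,\dfrac{2a^Tu}{\|a\|}\right)^{1/2}&\text{if } V^2\ge\dfrac{\|a\|^2}{t^{*2}}+\|u\|^2-\dfrac{2a^Tu}{t^*},\\ V&\text{otherwise,}\end{cases}\qquad t^*=\frac{\|a\|}{\sqrt{\|u\|^2+C}}.$$ In the first case the travel time is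 $t^*$; in the second it is $$\frac{1}{\|u\|^2-V^2}\left(a^Tu-\sqrt{(a^Tu)^2+\|a\|^2(V^2-\|u\|^2)}\right).$$
   Formalization: For L=1 the HJB equation is claimed except at x_0 and on the boundary of the reachable set, where ψ is not differentiable; energy optimality assumes ‖u‖²+C>0 (otherwise no minimizer); if ‖u‖=V the second travel-time formula (0/0) is not imposed; solutions are those induced by motions. *)

theory Defs
  imports "HOL-Analysis.Analysis"
begin

section \<open>The control problem\<close>

text \<open>
  A motion over \<open>[0, T]\<close> is a measurable control \<open>v\<close> together with its (Caratheodory) trajectory
  \<open>x\<close>: the equation \<open>x' = v + u\<close> is imposed in integral form, so \<open>x 0 = x0\<close> is the instance \<open>t = 0\<close>.
  The running cost \<open>L\<close> takes the position and the control.
\<close>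

definition admissible ::
  "'a::euclidean_space \<Rightarrow> real \<Rightarrow> 'a \<Rightarrow> 'a \<Rightarrow> real \<Rightarrow> (real \<Rightarrow> 'a) \<Rightarrow> (real \<Rightarrow> 'a) \<Rightarrow> bool" where
  "admissible u V x0 x1 T x v \<longleftrightarrow>
     0 \<le> T \<and>
     v \<in> borel_measurable (lebesgue_on {0..T}) \<and>
     (\<forall>t\<in>{0..T}. norm (v t) \<le> V) \<and>
     (\<forall>t\<in>{0..T}. ((\<lambda>s. v s + u) has_integral (x t - x0)) {0..t}) \<and>
     x T = x1"

definition cost ::
  "('a::euclidean_space \<Rightarrow> 'a \<Rightarrow> real) \<Rightarrow> real \<Rightarrow> (real \<Rightarrow> 'a) \<Rightarrow> (real \<Rightarrow> 'a) \<Rightarrow> real" where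
  "cost L T x v = integral {0..T} (\<lambda>t. L (x t) (v t))"

definition optimal ::
  "'a::euclidean_space \<Rightarrow> real \<Rightarrow> 'a \<Rightarrow> 'a \<Rightarrow> ('a \<Rightarrow> 'a \<Rightarrow> real) \<Rightarrow>
   real \<Rightarrow> (real \<Rightarrow> 'a) \<Rightarrow> (real \<Rightarrow> 'a) \<Rightarrow> bool" where
  "optimal u V x0 x1 L T x v \<longleftrightarrow>
     admissible u V x0 x1 T x v \<and>
     (\<forall>T' x' v'. admissible u V x0 x1 T' x' v' \<longrightarrow> cost L T x v \<le> cost L T' x' v')"

definition reachable :: "'a::euclidean_space \<Rightarrow> real \<Rightarrow> 'a \<Rightarrow> 'a set" where
  "reachable u V x0 = {x1. \<exists>T x v. admissible u V x0 x1 T x v}"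

text \<open>The trajectory from \<open>x0\<close> under the constant control \<open>v\<close>.\<close>

definition line_path :: "'a::euclidean_space \<Rightarrow> 'a \<Rightarrow> 'a \<Rightarrow> real \<Rightarrow> 'a" where
  "line_path u x0 v s = x0 + s *\<^sub>R (v + u)"

definition time_cost :: "'a::euclidean_space \<Rightarrow> 'a \<Rightarrow> real" where
  "time_cost x v = 1"

definition energy_cost :: "real \<Rightarrow> 'a::euclidean_space \<Rightarrow> 'a \<Rightarrow> real" where
  "energy_cost C x v = (norm v)\<^sup>2 + C"


section \<open>The Hamilton-Jacobi-Bellman equation\<close>

definition is_maximum :: "('a \<Rightarrow> real) \<Rightarrow> 'a set \<Rightarrow> real \<Rightarrow> bool" where
  "is_maximum f S m \<longleftrightarrow> (\<exists>w\<in>S. f w = m) \<and> (\<forall>w\<in>S. f w \<le> m)"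

definition finite_dom :: "('a \<Rightarrow> real \<Rightarrow> ereal) \<Rightarrow> ('a \<times> real) set" where
  "finite_dom \<psi> = {(x, t). \<bar>\<psi> x t\<bar> \<noteq> \<infinity>}"

text \<open>
  Here \<open>p\<close> is the spatial gradient and \<open>q\<close> the time derivative.  They are taken relative to the set
  where \<open>\<psi>\<close> is finite: this is the ordinary (total) derivative at interior points of that set, and
  makes sense of the equation also at its boundary points, where \<open>\<psi>\<close> jumps to infinity.
\<close>

definition hjb_at ::
  "('a::euclidean_space \<Rightarrow> 'a \<Rightarrow> real) \<Rightarrow> 'a \<Rightarrow> real \<Rightarrow> ('a \<Rightarrow> real \<Rightarrow> ereal) \<Rightarrow> 'a \<Rightarrow> real \<Rightarrow> bool" where
  "hjb_at L u V \<psi> x t \<longleftrightarrow>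
     (\<exists>p q m.
        ((\<lambda>(y, s). real_of_ereal (\<psi> y s)) has_derivative (\<lambda>(h, k). p \<bullet> h + q * k))
          (at (x, t) within finite_dom \<psi>) \<and>
        is_maximum (\<lambda>w. p \<bullet> (u + w) - L x w) {w. norm w \<le> V} m \<and>
        q + m = 0)"

text \<open>\<open>E\<close> is a set of exceptional positions, at which a solution is allowed not to be differentiable.\<close>

definition hjb_solution ::
  "('a::euclidean_space \<Rightarrow> 'a \<Rightarrow> real) \<Rightarrow> 'a \<Rightarrow> real \<Rightarrow> 'a set \<Rightarrow> ('a \<Rightarrow> real \<Rightarrow> ereal) \<Rightarrow> bool" where
  "hjb_solution L u V E \<psi> \<longleftrightarrow>
     (\<forall>x t. (x, t) \<in> finite_dom \<psi> \<and> 0 < t \<and> x \<notin> E \<longrightarrow> hjb_at L u V \<psi> x t)"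

text \<open>
  The minimum time is never differentiable at the starting point, nor (if \<open>V < norm u\<close>) on the
  boundary of the cone of reachable positions, where its gradient is unbounded.
  For \<open>norm u < V\<close> every position is reachable and only \<open>x0\<close> is exceptional.
\<close>

definition singular_positions :: "'a::euclidean_space \<Rightarrow> real \<Rightarrow> 'a \<Rightarrow> 'a set" where
  "singular_positions u V x0 = insert x0 (frontier (reachable u V x0))"

text \<open>
  \<open>\<psi>\<close> is the value function induced by some choice of motions starting at \<open>x0\<close>: whenever it is not
  infinite, \<open>\<psi> x t\<close> is the cost of an admissible motion reaching \<open>x\<close> within time \<open>t\<close>.
\<close>

definition induced_value ::
  "('a::euclidean_space \<Rightarrow> 'a \<Rightarrow> real) \<Rightarrow> 'a \<Rightarrow> real \<Rightarrow> 'a \<Rightarrow> ('a \<Rightarrow> real \<Rightarrow> ereal) \<Rightarrow> bool" where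
  "induced_value L u V x0 \<psi> \<longleftrightarrow>
     (\<forall>x t. \<psi> x t \<noteq> \<infinity> \<longrightarrow>
        (\<exists>T y v. T \<le> t \<and> admissible u V x0 x T y v \<and> \<psi> x t = ereal (cost L T y v)))"


section \<open>Maximum speed straight line motion\<close>

definition line_speed :: "'a::euclidean_space \<Rightarrow> real \<Rightarrow> 'a \<Rightarrow> real" where
  "line_speed u V a =
     (a \<bullet> u) / norm a + sqrt (((a \<bullet> u) / norm a)\<^sup>2 + V\<^sup>2 - (norm u)\<^sup>2)"

definition max_speed_motion :: "'a::euclidean_space \<Rightarrow> real \<Rightarrow> 'a \<Rightarrow> 'a \<Rightarrow> 'a \<Rightarrow> bool" where
  "max_speed_motion u V x0 x v \<longleftrightarrow>
     norm v = V \<and>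
     (\<exists>c>0. v + u = c *\<^sub>R (x - x0)) \<and>
     norm (v + u) = line_speed u V (x - x0)"

text \<open>
  If \<open>norm u \<ge> V\<close>, no maximum speed motion may exist; the value is then infinite.  The case
  \<open>x = x0\<close>, in which the direction of motion is undefined, is the motion of duration 0.
\<close>

definition psi_time :: "'a::euclidean_space \<Rightarrow> real \<Rightarrow> 'a \<Rightarrow> 'a \<Rightarrow> real \<Rightarrow> ereal" where
  "psi_time u V x0 x t =
     (if x = x0 then (if 0 \<le> t then 0 else \<infinity>)
      else if (\<exists>v. max_speed_motion u V x0 x v) \<and> norm (x - x0) / line_speed u V (x - x0) \<le> t
      then ereal (norm (x - x0) / line_speed u V (x - x0))
      else \<infinity>)"


section \<open>Energy-optimal constant velocity motion\<close>

definition psi_energy :: "'a::euclidean_space \<Rightarrow> real \<Rightarrow> real \<Rightarrow> 'a \<Rightarrow> 'a \<Rightarrow> real \<Rightarrow> ereal" where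
  "psi_energy u V C x0 x t =
     (let v = (1 / t) *\<^sub>R (x - x0) - u
      in if 0 < t \<and> norm v \<le> V then ereal (((norm v)\<^sup>2 + C) * t) else \<infinity>)"

definition t_star :: "'a::euclidean_space \<Rightarrow> real \<Rightarrow> 'a \<Rightarrow> real" where
  "t_star u C a = norm a / sqrt ((norm u)\<^sup>2 + C)"

definition unsaturated :: "'a::euclidean_space \<Rightarrow> real \<Rightarrow> real \<Rightarrow> 'a \<Rightarrow> bool" where
  "unsaturated u V C a \<longleftrightarrow>
     V\<^sup>2 \<ge> (norm a)\<^sup>2 / (t_star u C a)\<^sup>2 + (norm u)\<^sup>2 - 2 * (a \<bullet> u) / t_star u C a"

definition energy_speed :: "'a::euclidean_space \<Rightarrow> real \<Rightarrow> real \<Rightarrow> 'a \<Rightarrow> real" where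
  "energy_speed u V C a =
     (if unsaturated u V C a
      then sqrt (C + 2 * (norm u)\<^sup>2 - sqrt (C + (norm u)\<^sup>2) * (2 * (a \<bullet> u) / norm a))
      else V)"

definition energy_time :: "'a::euclidean_space \<Rightarrow> real \<Rightarrow> real \<Rightarrow> 'a \<Rightarrow> real" where
  "energy_time u V C a =
     (if unsaturated u V C a
      then t_star u C a
      else 1 / ((norm u)\<^sup>2 - V\<^sup>2) *
           (a \<bullet> u - sqrt ((a \<bullet> u)\<^sup>2 + (norm a)\<^sup>2 * (V\<^sup>2 - (norm u)\<^sup>2))))"

text \<open>
  The constant control \<open>v\<close> leads from \<open>x0\<close> to \<open>xf\<close> in time \<open>T\<close>.  In the saturated case with
  \<open>norm u = V\<close> the closed formula for the travel time is \<open>0 / 0\<close> and is not imposed; \<open>T\<close> is then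
  already determined by \<open>norm v = V\<close>.
\<close>

definition energy_motion ::
  "'a::euclidean_space \<Rightarrow> real \<Rightarrow> real \<Rightarrow> 'a \<Rightarrow> 'a \<Rightarrow> 'a \<Rightarrow> real \<Rightarrow> bool" where
  "energy_motion u V C x0 xf v T \<longleftrightarrow>
     0 < T \<and>
     v = (1 / T) *\<^sub>R (xf - x0) - u \<and>
     norm v = energy_speed u V C (xf - x0) \<and>
     (unsaturated u V C (xf - x0) \<or> norm u \<noteq> V \<longrightarrow> T = energy_time u V C (xf - x0))"

end

theory Submission
  imports Defs
begin

text \<open>
  Everything rests on one change of variable.  Reaching \<open>x0 + a\<close> at time \<open>T\<close> forces the mean of the
  control to be \<open>a / T - u\<close>, whatever the motion; so \<open>T\<close> can be attained exactly when this vector has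
  norm at most \<open>V\<close>.  In terms of the ground speed \<open>s = norm a / T\<close>, of the component \<open>c\<close> of the flow
  along \<open>a\<close>, and of \<open>d = c\<^sup>2 + V\<^sup>2 - (norm u)\<^sup>2\<close>, the condition reads \<open>(s - c)\<^sup>2 \<le> d\<close>
  (\<open>control_norm_le_iff\<close>).  If there are admissible ground speeds, they are therefore the positive points of the interval
  \<open>[c - sqrt d, c + sqrt d]\<close>, and the right end point is \<open>line_speed\<close>: the maximum speed
  motion is the fastest one.

  For the energy, the convexity of \<open>(norm v)\<^sup>2\<close> shows that the constant control equal to the
  mean is at least as cheap as the original one (\<open>cost_energy_ge\<close>).  What remains is to minimize
  over \<open>s\<close> the cost of a constant control, which is \<open>norm a * (s + w\<^sup>2 / s) - 2 * (a \<bullet> u)\<close> with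
  \<open>w\<^sup>2 = (norm u)\<^sup>2 + C\<close>.  It decreases up to \<open>s = w\<close> and increases afterwards.  The unsaturated case
  is the one where \<open>w\<close> is an admissible speed.  In the saturated case \<open>w\<close> lies outside the interval of admissible speeds, and not
  below it, because the product \<open>(norm u)\<^sup>2 - V\<^sup>2\<close> of the end points is at most \<open>w\<^sup>2\<close>; so all admissible
  speeds are less than \<open>w\<close>, and the best choice is the maximum speed, that is, the minimum time motion (\<open>energy_motion_speed\<close>).

  The energy value is an explicit smooth function with spatial gradient \<open>2 v\<close>, and the maximum in its
  Hamilton-Jacobi-Bellman equation is found by completing the square.  The minimum time \<open>\<tau>\<close> satisfies
  \<open>(norm (a - \<tau> u))\<^sup>2 = V\<^sup>2 \<tau>\<^sup>2\<close>, and implicit differentiation gives the gradient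
  \<open>v / (v \<bullet> (v + u))\<close>; being a positive multiple of \<open>v\<close>, it makes \<open>v\<close> itself the maximizing control.
  This needs \<open>d > 0\<close>, which holds away from the boundary of the reachable set (\<open>speed_disc_pos\<close>) unless
  \<open>V = 0\<close>; in that case only a ray is reachable and the value is linear on it.

  A solution of the equation that is induced by motions takes costs of actual motions as its
  values, hence cannot be smaller than the optimal cost.
\<close>

section \<open>Ground speed and mean control\<close>

definition along :: "'a::euclidean_space \<Rightarrow> 'a \<Rightarrow> real" where
  "along u a = (a \<bullet> u) / norm a"

definition speed_disc :: "'a::euclidean_space \<Rightarrow> real \<Rightarrow> 'a \<Rightarrow> real" where
  "speed_disc u V a = (along u a)\<^sup>2 + V\<^sup>2 - (norm u)\<^sup>2"

lemma line_speed_eq: "line_speed u V a = along u a + sqrt (speed_disc u V a)"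
  by (simp add: line_speed_def along_def speed_disc_def)

text \<open>
  The control that yields the velocity \<open>a / T\<close> is, in the plane of \<open>a\<close> and \<open>u\<close>, the difference of
  two vectors whose components along \<open>a\<close> are \<open>norm a / T\<close> and \<open>along u a\<close>; the square completed here
  is Pythagoras for that difference.
\<close>

lemma control_norm_identity:
  fixes a u :: "'a::euclidean_space"
  assumes "a \<noteq> 0" "T \<noteq> 0"
  shows "(norm ((1 / T) *\<^sub>R a - u))\<^sup>2 = V\<^sup>2 + (norm a / T - along u a)\<^sup>2 - speed_disc u V a"
proof -
  have "(norm ((1 / T) *\<^sub>R a - u))\<^sup>2 = (norm a / T)\<^sup>2 - 2 * (a \<bullet> u) / T + (norm u)\<^sup>2"
    unfolding power_divide power2_norm_eq_inner
    by (simp add: inner_diff_left inner_diff_right inner_commute power2_eq_square)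
  also have "2 * (a \<bullet> u) / T = 2 * (norm a / T) * along u a"
    using assms by (simp add: along_def)
  finally show ?thesis by (simp add: speed_disc_def power2_diff algebra_simps)
qed

lemma control_norm_le_iff:
  fixes a u :: "'a::euclidean_space"
  assumes "a \<noteq> 0" "T \<noteq> 0" "0 \<le> V"
  shows "norm ((1 / T) *\<^sub>R a - u) \<le> V \<longleftrightarrow> (norm a / T - along u a)\<^sup>2 \<le> speed_disc u V a"
proof -
  have "norm ((1 / T) *\<^sub>R a - u) \<le> V \<longleftrightarrow> (norm ((1 / T) *\<^sub>R a - u))\<^sup>2 \<le> V\<^sup>2"
    using assms(3) by (simp add: abs_le_square_iff[symmetric])
  then show ?thesis using control_norm_identity[OF assms(1,2), of u V] by simp
qed

lemma control_norm_eq_iff: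
  fixes a u :: "'a::euclidean_space"
  assumes "a \<noteq> 0" "T \<noteq> 0" "0 \<le> V"
  shows "norm ((1 / T) *\<^sub>R a - u) = V \<longleftrightarrow> (norm a / T - along u a)\<^sup>2 = speed_disc u V a"
proof -
  have "norm ((1 / T) *\<^sub>R a - u) = V \<longleftrightarrow> (norm ((1 / T) *\<^sub>R a - u))\<^sup>2 = V\<^sup>2"
    using assms(3) by (simp add: power2_eq_iff_nonneg)
  then show ?thesis using control_norm_identity[OF assms(1,2), of u V] by simp
qed

text \<open>
  Integrating \<open>x' = v + u\<close> determines the mean of the control, and a mean of vectors in a ball stays
  in the ball.  Through this fact an arbitrary motion can be compared with the straight one that has
  the same end points and duration.
\<close>

lemma admissible_mean_control:
  fixes u :: "'a::euclidean_space"
  assumes adm: "admissible u V x0 x1 T x v" and V: "0 \<le> V" and ne: "x1 \<noteq> x0"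
  defines "m \<equiv> (1 / T) *\<^sub>R (x1 - x0) - u"
  shows "0 < T" and "norm m \<le> V" and "(v has_integral T *\<^sub>R m) {0..T}"
proof -
  have T0: "0 \<le> T" and nv: "\<And>t. t \<in> {0..T} \<Longrightarrow> norm (v t) \<le> V"
    and I: "\<And>t. t \<in> {0..T} \<Longrightarrow> ((\<lambda>s. v s + u) has_integral (x t - x0)) {0..t}"
    and xT: "x T = x1"
    using adm by (auto simp: admissible_def)
  show T: "0 < T"
  proof (rule ccontr)
    assume "\<not> 0 < T"
    then have "T = 0" using T0 by simp
    then have "((\<lambda>s. v s + u) has_integral (x1 - x0)) {0}" using I[of 0] xT by simp
    moreover have "((\<lambda>s. v s + u) has_integral 0) {0}" by (simp add: has_integral_refl)
    ultimately have "x1 - x0 = 0" by (rule has_integral_unique)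
    then show False using ne by simp
  qed
  have c: "((\<lambda>s. u) has_integral T *\<^sub>R u) {0..T}"
    using has_integral_const_real[of u 0 T] T by simp
  have "((\<lambda>s. (v s + u) - u) has_integral ((x1 - x0) - T *\<^sub>R u)) {0..T}"
    using has_integral_diff[OF I[of T] c] T xT by simp
  moreover have "(x1 - x0) - T *\<^sub>R u = T *\<^sub>R m"
    using T by (simp add: m_def scaleR_diff_right)
  ultimately show int: "(v has_integral T *\<^sub>R m) {0..T}" by simp
  have "norm (T *\<^sub>R m) \<le> V * T"
    using has_integral_bound[of V v "T *\<^sub>R m" 0 T] V int nv T by (simp add: box_real)
  then show "norm m \<le> V" using T by simp
qed

lemma line_path_admissible:
  fixes u :: "'a::euclidean_space"
  assumes "0 \<le> T" "norm v \<le> V" "x0 + T *\<^sub>R (v + u) = x1"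
  shows "admissible u V x0 x1 T (line_path u x0 v) (\<lambda>_. v)"
proof -
  have "((\<lambda>s. v + u) has_integral (line_path u x0 v t - x0)) {0..t}" if "t \<in> {0..T}" for t
    using has_integral_const_real[of "v + u" 0 t] that by (simp add: line_path_def)
  then show ?thesis using assms by (auto simp: admissible_def line_path_def)
qed

lemma cost_time_eq: "0 \<le> T \<Longrightarrow> cost time_cost T x v = T"
  by (simp add: cost_def time_cost_def)

lemma cost_energy_line:
  "0 \<le> T \<Longrightarrow> cost (energy_cost C) T x (\<lambda>_. v) = ((norm v)\<^sup>2 + C) * T"
  by (simp add: cost_def energy_cost_def)

text \<open>
  Jensen's inequality for the squared norm.  Integrating the tangent inequality
  \<open>(norm v)\<^sup>2 \<ge> 2 * (m \<bullet> v) - (norm m)\<^sup>2\<close> at the mean \<open>m\<close> proves it, since the right-hand side has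
  integral \<open>(norm m)\<^sup>2 * T\<close>.
\<close>

lemma cost_energy_ge:
  fixes u :: "'a::euclidean_space"
  assumes adm: "admissible u V x0 x1 T x v" and V: "0 \<le> V" and ne: "x1 \<noteq> x0"
  shows "((norm ((1 / T) *\<^sub>R (x1 - x0) - u))\<^sup>2 + C) * T \<le> cost (energy_cost C) T x v"
proof -
  define m where "m = (1 / T) *\<^sub>R (x1 - x0) - u"
  note mc = admissible_mean_control[OF adm V ne, folded m_def]
  have meas: "v \<in> borel_measurable (lebesgue_on {0..T})"
    and nv: "\<And>t. t \<in> {0..T} \<Longrightarrow> norm (v t) \<le> V"
    using adm by (auto simp: admissible_def)
  have "(\<lambda>t. (norm (v t))\<^sup>2 + C) integrable_on {0..T}"
  proof (rule measurable_bounded_by_integrable_imp_integrable)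
    show "(\<lambda>t. (norm (v t))\<^sup>2 + C) \<in> borel_measurable (lebesgue_on {0..T})"
      using meas by measurable
    show "(\<lambda>t. V\<^sup>2 + \<bar>C\<bar>) integrable_on {0..T}" by (rule integrable_const_ivl)
    show "norm ((norm (v t))\<^sup>2 + C) \<le> V\<^sup>2 + \<bar>C\<bar>" if "t \<in> {0..T}" for t
    proof -
      have "(norm (v t))\<^sup>2 \<le> V\<^sup>2" using nv[OF that] by (simp add: power_mono)
      then show ?thesis using zero_le_power2[of "norm (v t)"] by (simp only: real_norm_def)
    qed
  qed auto
  moreover have "((\<lambda>t. (2 *\<^sub>R m) \<bullet> v t + (C - (norm m)\<^sup>2)) has_integral
      (2 *\<^sub>R m) \<bullet> (T *\<^sub>R m) + (C - (norm m)\<^sup>2) * T) {0..T}"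
    using has_integral_add[OF has_integral_linear[OF mc(3) bounded_linear_inner_right[of "2 *\<^sub>R m"], unfolded o_def]
        has_integral_const_real[of "C - (norm m)\<^sup>2" 0 T]] mc(1)
    by (simp add: mult.commute)
  ultimately have "(2 *\<^sub>R m) \<bullet> (T *\<^sub>R m) + (C - (norm m)\<^sup>2) * T
      \<le> integral {0..T} (\<lambda>t. (norm (v t))\<^sup>2 + C)"
  proof (elim has_integral_le[OF _ integrable_integral])
    fix t
    have "0 \<le> (norm (v t - m))\<^sup>2" by simp
    then show "(2 *\<^sub>R m) \<bullet> v t + (C - (norm m)\<^sup>2) \<le> (norm (v t))\<^sup>2 + C"
      by (simp add: power2_norm_eq_inner inner_diff_left inner_diff_right inner_commute)
  qed
  then have "((norm m)\<^sup>2 + C) * T \<le> integral {0..T} (\<lambda>t. (norm (v t))\<^sup>2 + C)"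
    by (simp add: power2_norm_eq_inner algebra_simps)
  then show ?thesis unfolding m_def cost_def energy_cost_def .
qed

section \<open>The minimum time motion\<close>

lemma line_speed_ge:
  fixes a u :: "'a::euclidean_space"
  assumes "a \<noteq> 0" "T \<noteq> 0" "0 \<le> V" "norm ((1 / T) *\<^sub>R a - u) \<le> V"
  shows "0 \<le> speed_disc u V a" and "norm a / T \<le> line_speed u V a"
proof -
  have le: "(norm a / T - along u a)\<^sup>2 \<le> speed_disc u V a"
    using control_norm_le_iff[OF assms(1-3)] assms(4) by blast
  then show "0 \<le> speed_disc u V a"
    using zero_le_power2[of "norm a / T - along u a"] by linarith
  show "norm a / T \<le> line_speed u V a"
    using real_le_rsqrt[OF le] by (simp add: line_speed_eq)
qed

text \<open>
  The last condition in the definition of a maximum speed motion selects the larger root of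
  \<open>(s - along u a)\<^sup>2 = speed_disc u V a\<close>.  A real and positive larger root is all that existence requires.
\<close>

lemma max_speed_motion_iff:
  fixes u :: "'a::euclidean_space"
  assumes "x \<noteq> x0" "0 \<le> V"
  shows "max_speed_motion u V x0 x v \<longleftrightarrow>
    0 \<le> speed_disc u V (x - x0) \<and> 0 < line_speed u V (x - x0) \<and>
    v = (line_speed u V (x - x0) / norm (x - x0)) *\<^sub>R (x - x0) - u"
    (is "?l \<longleftrightarrow> ?r")
proof -
  define a where "a = x - x0"
  define s where "s = line_speed u V a"
  have a: "a \<noteq> 0" using assms by (simp add: a_def)
  have root: "norm ((s / norm a) *\<^sub>R a - u) = V \<longleftrightarrow> (s - along u a)\<^sup>2 = speed_disc u V a"
    if "0 < s"
    using control_norm_eq_iff[OF a, of "norm a / s" V u] a that assms(2) by simp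
  show ?thesis
  proof
    assume ?l
    then obtain k where k: "norm v = V" "k > 0" "v + u = k *\<^sub>R a" "norm (v + u) = s"
      by (auto simp: max_speed_motion_def a_def s_def)
    have s: "s = k * norm a" using k by simp
    then have spos: "0 < s" using k a by simp
    have "v = (s / norm a) *\<^sub>R a - u" using k(3) s a by (simp add: algebra_simps)
    moreover from this have "0 \<le> speed_disc u V a"
      using root[OF spos] k(1) zero_le_power2[of "s - along u a"] by simp
    ultimately show ?r using spos unfolding s_def a_def by blast
  next
    assume ?r
    then have r: "0 \<le> speed_disc u V a" "0 < s" "v = (s / norm a) *\<^sub>R a - u"
      by (auto simp: a_def s_def)
    have "(s - along u a)\<^sup>2 = speed_disc u V a" using r by (simp add: s_def line_speed_eq)
    then have "norm v = V" using root r by simp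
    moreover have "v + u = (s / norm a) *\<^sub>R a" using r by simp
    moreover have "0 < s / norm a" using a r by simp
    moreover have "norm (v + u) = s" using r a by simp
    ultimately show ?l unfolding max_speed_motion_def a_def s_def by blast
  qed
qed

lemma max_speed_motion_exists:
  fixes u :: "'a::euclidean_space"
  assumes "x \<noteq> x0" "0 \<le> V" "x \<in> reachable u V x0"
  shows "\<exists>v. max_speed_motion u V x0 x v"
proof -
  obtain T y v where adm: "admissible u V x0 x T y v" using assms by (auto simp: reachable_def)
  note mc = admissible_mean_control[OF adm assms(2,1)]
  have a: "x - x0 \<noteq> 0" using assms by simp
  have "0 \<le> speed_disc u V (x - x0)" "norm (x - x0) / T \<le> line_speed u V (x - x0)"
    using line_speed_ge[OF a, of T V u] mc(1,2) assms(2) by auto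
  moreover have "0 < norm (x - x0) / T" using a mc(1) by simp
  ultimately show ?thesis using max_speed_motion_iff[OF assms(1,2)] by (metis less_le_trans)
qed

lemma max_speed_time_le:
  fixes u :: "'a::euclidean_space"
  assumes adm: "admissible u V x0 x1 T x v" and V: "0 \<le> V" and ne: "x1 \<noteq> x0"
  shows "norm (x1 - x0) / line_speed u V (x1 - x0) \<le> T"
proof -
  note mc = admissible_mean_control[OF adm V ne]
  have a: "x1 - x0 \<noteq> 0" using ne by simp
  have "norm (x1 - x0) / T \<le> line_speed u V (x1 - x0)"
    using line_speed_ge[OF a, of T V u] mc V by auto
  moreover have "0 < norm (x1 - x0) / T" using a mc(1) by simp
  ultimately have "0 < line_speed u V (x1 - x0)" "norm (x1 - x0) \<le> line_speed u V (x1 - x0) * T"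
    using mc(1) by (linarith, simp add: pos_divide_le_eq)
  then show ?thesis by (simp add: pos_divide_le_eq mult.commute)
qed

lemma max_speed_motion_admissible:
  fixes u :: "'a::euclidean_space"
  assumes "x \<noteq> x0" "0 \<le> V" "max_speed_motion u V x0 x v"
  shows "admissible u V x0 x (norm (x - x0) / line_speed u V (x - x0)) (line_path u x0 v) (\<lambda>_. v)"
proof -
  have *: "0 < line_speed u V (x - x0)"
    "v = (line_speed u V (x - x0) / norm (x - x0)) *\<^sub>R (x - x0) - u"
    using assms(3) by (auto simp: max_speed_motion_iff[OF assms(1,2)])
  have "norm v = V" using assms(3) by (simp add: max_speed_motion_def)
  then show ?thesis
    using * assms(1) by (intro line_path_admissible) auto
qed

lemma induced_value_psi_time:
  fixes u :: "'a::euclidean_space"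
  assumes V: "0 \<le> V"
  shows "induced_value time_cost u V x0 (psi_time u V x0)"
  unfolding induced_value_def
proof (intro allI impI)
  fix x t assume fin: "psi_time u V x0 x t \<noteq> \<infinity>"
  show "\<exists>T y v. T \<le> t \<and> admissible u V x0 x T y v \<and> psi_time u V x0 x t = ereal (cost time_cost T y v)"
  proof (cases "x = x0")
    case True
    then have "0 \<le> t" "psi_time u V x0 x t = 0"
      using fin by (auto simp: psi_time_def split: if_splits)
    moreover have "admissible u V x0 x 0 (line_path u x0 0) (\<lambda>_. 0)"
      using V True by (intro line_path_admissible) auto
    ultimately show ?thesis using cost_time_eq[of 0] by (metis order_refl zero_ereal_def)
  next
    case False
    then obtain v where v: "max_speed_motion u V x0 x v"
      and t: "norm (x - x0) / line_speed u V (x - x0) \<le> t"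
      and p: "psi_time u V x0 x t = ereal (norm (x - x0) / line_speed u V (x - x0))"
      using fin False unfolding psi_time_def by (metis (no_types, lifting))
    have adm: "admissible u V x0 x (norm (x - x0) / line_speed u V (x - x0)) (line_path u x0 v) (\<lambda>_. v)"
      using max_speed_motion_admissible[OF False V v] .
    then have "0 \<le> norm (x - x0) / line_speed u V (x - x0)" by (simp add: admissible_def)
    then show ?thesis using t p adm cost_time_eq by metis
  qed
qed

lemma optimal_time:
  fixes u :: "'a::euclidean_space"
  assumes "x \<noteq> x0" "0 \<le> V" "max_speed_motion u V x0 x v"
  shows "optimal u V x0 x time_cost (norm (x - x0) / line_speed u V (x - x0)) (line_path u x0 v) (\<lambda>_. v)"
proof -
  note adm = max_speed_motion_admissible[OF assms]
  have "cost time_cost (norm (x - x0) / line_speed u V (x - x0)) (line_path u x0 v) (\<lambda>_. v)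
     \<le> cost time_cost T' x' v'" if "admissible u V x0 x T' x' v'" for T' x' v'
  proof -
    have "0 \<le> norm (x - x0) / line_speed u V (x - x0)" "0 \<le> T'"
      using adm that by (simp_all add: admissible_def)
    then show ?thesis
      using max_speed_time_le[OF that assms(2,1)] by (simp only: cost_time_eq)
  qed
  then show ?thesis using adm by (auto simp: optimal_def)
qed

text \<open>
  Finite values of \<open>\<phi>\<close> are costs of motions to \<open>x1\<close>, with which the optimal motion competes.
\<close>

lemma optimal_le_induced_value:
  assumes "optimal u V x0 x1 L T x v" "induced_value L u V x0 \<phi>"
  shows "ereal (cost L T x v) \<le> \<phi> x1 t"
proof (cases "\<phi> x1 t = \<infinity>")
  case False
  then obtain T' y w where "admissible u V x0 x1 T' y w" "\<phi> x1 t = ereal (cost L T' y w)"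
    using assms(2) by (metis induced_value_def)
  then show ?thesis using assms(1) by (simp add: optimal_def)
qed simp

section \<open>The Hamilton-Jacobi-Bellman equation for the minimum time\<close>

text \<open>
  The explicit formula serves only to show that the minimum time \<open>\<tau>\<close> is differentiable.  The value of
  its derivative \<open>D\<close> comes from differentiating \<open>(norm (a - \<tau> u))\<^sup>2 = V\<^sup>2 \<tau>\<^sup>2\<close>, which gives
  \<open>v \<bullet> (h - D h u) = V\<^sup>2 * D h\<close>, where \<open>V\<^sup>2 = v \<bullet> v\<close>.  The denominator equals
  \<open>line_speed * sqrt speed_disc\<close>, so the gradient blows up where the discriminant vanishes.
\<close>

lemma max_speed_time_has_derivative:
  fixes a u :: "'a::euclidean_space"
  assumes a: "a \<noteq> 0" and d: "0 < speed_disc u V a" and s: "0 < line_speed u V a" and V: "0 \<le> V"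
  defines "v \<equiv> (line_speed u V a / norm a) *\<^sub>R a - u"
  shows "0 < v \<bullet> (v + u)"
    and "((\<lambda>y. norm y / line_speed u V y) has_derivative (\<lambda>h. (v \<bullet> h) / (v \<bullet> (v + u)))) (at a)"
proof -
  define \<tau> where "\<tau> = (\<lambda>y. norm y / line_speed u V y)"
  have tau: "0 < \<tau> a" using a s by (simp add: \<tau>_def)
  have v: "v = (1 / \<tau> a) *\<^sub>R a - u" by (simp add: v_def \<tau>_def)
  have "v \<bullet> (v + u) = line_speed u V a / norm a * ((line_speed u V a / norm a) * (norm a)\<^sup>2 - a \<bullet> u)"
    by (simp add: v_def inner_diff_left inner_commute power2_norm_eq_inner algebra_simps)
  also have "\<dots> = line_speed u V a * (line_speed u V a - along u a)"
    using a by (simp add: along_def power2_eq_square field_simps)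
  also have "\<dots> = line_speed u V a * sqrt (speed_disc u V a)" by (simp add: line_speed_eq)
  also have "\<dots> > 0" using d s by simp
  finally show K: "0 < v \<bullet> (v + u)" .
  have "(\<lambda>y. (y \<bullet> u) / norm y) differentiable (at a)"
    using a by (intro derivative_intros differentiable_norm_at) auto
  then obtain A where A: "(along u has_derivative A) (at a)"
    by (auto simp: differentiable_def along_def[abs_def])
  have disc: "(speed_disc u V has_derivative (\<lambda>h. 2 * along u a * A h)) (at a)"
    unfolding speed_disc_def[abs_def] by (auto intro!: derivative_eq_intros A)
  have ls: "line_speed u V differentiable (at a)"
    unfolding line_speed_eq[abs_def]
    using has_derivative_add[OF A has_derivative_real_sqrt[OF d disc]]
    by (auto simp: differentiable_def)
  have "\<tau> differentiable (at a)"
    unfolding \<tau>_def using a s ls by (intro derivative_intros differentiable_norm_at) auto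
  then obtain D where D: "(\<tau> has_derivative D) (at a)" by (auto simp: differentiable_def)
  have zero: "(y - \<tau> y *\<^sub>R u) \<bullet> (y - \<tau> y *\<^sub>R u) - V\<^sup>2 * (\<tau> y)\<^sup>2 = 0"
    if "0 < speed_disc u V y" "0 < line_speed u V y" "y \<noteq> 0" for y
  proof -
    have t: "\<tau> y \<noteq> 0" using that by (simp add: \<tau>_def)
    have "norm y / \<tau> y = line_speed u V y" using that by (simp add: \<tau>_def)
    then have "norm ((1 / \<tau> y) *\<^sub>R y - u) = V"
      using control_norm_eq_iff[OF that(3) t V] that by (simp add: line_speed_eq)
    moreover have "y - \<tau> y *\<^sub>R u = \<tau> y *\<^sub>R ((1 / \<tau> y) *\<^sub>R y - u)"
      using t by (simp add: scaleR_diff_right)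
    ultimately show ?thesis
      by (simp add: power2_norm_eq_inner[symmetric] power_mult_distrib)
  qed
  have "\<forall>\<^sub>F y in at a. 0 < speed_disc u V y"
    using order_tendstoD(1)[OF isContD[OF has_derivative_continuous[OF disc]] d] .
  moreover have "\<forall>\<^sub>F y in at a. 0 < line_speed u V y"
    using order_tendstoD(1)[OF isContD[OF differentiable_imp_continuous_within[OF ls]] s] .
  moreover have "\<forall>\<^sub>F y in at a. y \<noteq> 0"
    using a by (intro tendsto_imp_eventually_ne[OF tendsto_ident_at])
  ultimately have ev: "\<forall>\<^sub>F y in at a. (y - \<tau> y *\<^sub>R u) \<bullet> (y - \<tau> y *\<^sub>R u) - V\<^sup>2 * (\<tau> y)\<^sup>2 = 0"
    by eventually_elim (rule zero)
  have "((\<lambda>y. (y - \<tau> y *\<^sub>R u) \<bullet> (y - \<tau> y *\<^sub>R u) - V\<^sup>2 * (\<tau> y)\<^sup>2) has_derivative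
      (\<lambda>h. 2 * ((a - \<tau> a *\<^sub>R u) \<bullet> (h - D h *\<^sub>R u)) - V\<^sup>2 * (2 * \<tau> a * D h))) (at a)"
    by (auto intro!: derivative_eq_intros D simp: inner_commute)
  then have "((\<lambda>y. 0) has_derivative
      (\<lambda>h. 2 * ((a - \<tau> a *\<^sub>R u) \<bullet> (h - D h *\<^sub>R u)) - V\<^sup>2 * (2 * \<tau> a * D h))) (at a)"
    by (rule has_derivative_transform_eventually) (use ev zero[OF d s a] in auto)
  then have "(\<lambda>h. 2 * ((a - \<tau> a *\<^sub>R u) \<bullet> (h - D h *\<^sub>R u)) - V\<^sup>2 * (2 * \<tau> a * D h)) = (\<lambda>h. 0)"
    using has_derivative_unique has_derivative_const by blast
  then have eq: "2 * ((a - \<tau> a *\<^sub>R u) \<bullet> (h - D h *\<^sub>R u)) - V\<^sup>2 * (2 * \<tau> a * D h) = 0" for h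
    by meson
  have av: "a - \<tau> a *\<^sub>R u = \<tau> a *\<^sub>R v" using tau by (simp add: v scaleR_diff_right)
  have "V\<^sup>2 * (\<tau> a)\<^sup>2 = (\<tau> a)\<^sup>2 * (v \<bullet> v)"
    using zero[OF d s a] by (auto simp: av power2_eq_square algebra_simps)
  then have VV: "V\<^sup>2 = v \<bullet> v" using tau by simp
  have "D h = (v \<bullet> h) / (v \<bullet> (v + u))" for h
  proof -
    have "2 * \<tau> a * (v \<bullet> h - D h * (v \<bullet> (v + u))) = 0"
      using eq[of h] unfolding av VV by (simp add: inner_diff_right inner_add_right algebra_simps)
    then show ?thesis using tau K by (simp add: field_simps)
  qed
  then have "D = (\<lambda>h. (v \<bullet> h) / (v \<bullet> (v + u)))" by auto
  then show "((\<lambda>y. norm y / line_speed u V y) has_derivative (\<lambda>h. (v \<bullet> h) / (v \<bullet> (v + u)))) (at a)"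
    using D by (simp add: \<tau>_def)
qed

lemma finite_dom_psi_time:
  fixes u :: "'a::euclidean_space"
  assumes "(x, t) \<in> finite_dom (psi_time u V x0)" "x \<noteq> x0"
  shows "\<exists>v. max_speed_motion u V x0 x v"
    and "psi_time u V x0 x t = ereal (norm (x - x0) / line_speed u V (x - x0))"
  using assms unfolding finite_dom_def psi_time_def by (auto split: if_splits)

text \<open>
  A vehicle with \<open>V > 0\<close> meets a vanishing discriminant only on the boundary of the cone of reachable
  positions: starting from such a position and moving a little upstream, that is by
  \<open>- r *\<^sub>R u\<close>, one leaves the cone, since \<open>speed_disc * (norm a)\<^sup>2\<close> becomes
  \<open>- r * V\<^sup>2 * (2 * (a \<bullet> u) - r * (norm u)\<^sup>2)\<close>.
\<close>

lemma speed_disc_pos: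
  fixes u :: "'a::euclidean_space"
  assumes ne: "x \<noteq> x0" and V: "0 < V" and int: "x \<in> interior (reachable u V x0)"
  shows "0 < speed_disc u V (x - x0)"
proof -
  define a where "a = x - x0"
  have a: "a \<noteq> 0" using ne by (simp add: a_def)
  obtain w where w: "max_speed_motion u V x0 x w"
    using max_speed_motion_exists[OF ne, of V u] V int interior_subset by fastforce
  have nn: "0 \<le> speed_disc u V a" and s: "0 < line_speed u V a"
    using w V by (auto simp: max_speed_motion_iff[OF ne] a_def)
  have "speed_disc u V a \<noteq> 0"
  proof
    assume z: "speed_disc u V a = 0"
    then have "0 < along u a" using s by (simp add: line_speed_eq)
    then have au: "0 < a \<bullet> u" using a by (simp add: along_def zero_less_divide_iff)
    then have u: "u \<noteq> 0" by auto
    obtain e where e: "0 < e" "ball x e \<subseteq> reachable u V x0"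
      using int by (auto simp: mem_interior)
    (* the first bound keeps the perturbed position in the ball, the second keeps it different from
       x0 and makes the perturbed discriminant negative *)
    define r where "r = min (e / (2 * norm u)) ((a \<bullet> u) / (2 * (norm u)\<^sup>2))"
    have r: "0 < r" using e au u by (simp add: r_def)
    have "r * norm u \<le> e / (2 * norm u) * norm u" by (intro mult_right_mono) (simp_all add: r_def)
    then have r1: "r * norm u < e" using e(1) u by simp
    have "r * (norm u)\<^sup>2 \<le> (a \<bullet> u) / (2 * (norm u)\<^sup>2) * (norm u)\<^sup>2"
      by (intro mult_right_mono) (simp_all add: r_def)
    then have r2: "r * (norm u)\<^sup>2 < a \<bullet> u" using au u by simp
    define b where "b = a - r *\<^sub>R u"
    have "b \<bullet> u = a \<bullet> u - r * (norm u)\<^sup>2"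
      by (simp add: b_def inner_diff_left power2_norm_eq_inner)
    then have b: "b \<noteq> 0" using r2 by auto
    have "x0 + b \<in> ball x e" using r r1 by (simp add: b_def a_def dist_norm)
    then have "x0 + b \<in> reachable u V x0" using e by blast
    then have "\<exists>w. max_speed_motion u V x0 (x0 + b) w"
      using max_speed_motion_exists[of "x0 + b" x0 V u] b V by auto
    then have "0 \<le> speed_disc u V b"
      using b V by (auto simp: max_speed_motion_iff)
    have scaled: "speed_disc u V y * (norm y)\<^sup>2 = (y \<bullet> u)\<^sup>2 + (V\<^sup>2 - (norm u)\<^sup>2) * (norm y)\<^sup>2"
      if "y \<noteq> 0" for y
      using that by (simp add: speed_disc_def along_def power_divide field_simps)
    have "0 \<le> speed_disc u V b * (norm b)\<^sup>2" using \<open>0 \<le> speed_disc u V b\<close> by simp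
    also have "\<dots> = (b \<bullet> u)\<^sup>2 + (V\<^sup>2 - (norm u)\<^sup>2) * (norm b)\<^sup>2" using scaled[OF b] .
    also have "\<dots> = speed_disc u V a * (norm a)\<^sup>2 - r * V\<^sup>2 * (2 * (a \<bullet> u) - r * (norm u)\<^sup>2)"
      unfolding scaled[OF a] unfolding power2_norm_eq_inner b_def
      by (simp add: inner_diff_left inner_diff_right inner_commute power2_eq_square algebra_simps)
    also have "\<dots> < 0" using z r V r2 au by simp
    finally show False by simp
  qed
  then show ?thesis using nn by (simp add: a_def)
qed

text \<open>
  Without propulsion the vehicle drifts along the ray from \<open>x0\<close> in direction \<open>u\<close>, where the
  discriminant vanishes throughout, except at \<open>x0\<close>.  On this ray, which carries the whole domain of finiteness, the
  value agrees with the linear function of gradient \<open>u / (norm u)\<^sup>2\<close>, and \<open>0\<close> is the only control.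
\<close>

lemma hjb_time_at_zero_speed:
  fixes u :: "'a::euclidean_space"
  assumes fin: "(x, t) \<in> finite_dom (psi_time u 0 x0)" and ne: "x \<noteq> x0"
  shows "hjb_at time_cost u 0 (psi_time u 0 x0) x t"
proof -
  define p where "p = (1 / (norm u)\<^sup>2) *\<^sub>R u"
  have motion: "u \<noteq> 0 \<and> norm (y - x0) / line_speed u 0 (y - x0) = p \<bullet> (y - x0)"
    if mot: "\<exists>v. max_speed_motion u 0 x0 y v" and y: "y \<noteq> x0" for y
  proof -
    obtain v k where "norm v = 0" "k > 0" "v + u = k *\<^sub>R (y - x0)"
        "norm (v + u) = line_speed u 0 (y - x0)"
      using mot unfolding max_speed_motion_def by blast
    then have k: "k > 0" "u = k *\<^sub>R (y - x0)" "norm u = line_speed u 0 (y - x0)"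
      by (simp_all only: norm_eq_zero add_0)
    have "norm (y - x0) / line_speed u 0 (y - x0) = 1 / k"
    proof -
      have "norm u = k * norm (y - x0)" using k(1) by (subst k(2)) simp
      then show ?thesis using k(1) y by (simp add: k(3)[symmetric])
    qed
    moreover have "p \<bullet> (y - x0) = 1 / k"
    proof -
      have "norm u = k * norm (y - x0)" using k(1) by (subst k(2)) simp
      moreover have "u \<bullet> (y - x0) = k * (norm (y - x0))\<^sup>2"
        by (subst k(2)) (simp add: power2_norm_eq_inner)
      ultimately show ?thesis
        using k(1) y by (simp add: p_def power2_eq_square)
    qed
    moreover have "u \<noteq> 0" using k(1) y by (subst k(2)) simp
    ultimately show ?thesis by simp
  qed
  have u: "u \<noteq> 0" using motion finite_dom_psi_time(1)[OF fin ne] ne by blast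
  have "((\<lambda>(y, s). p \<bullet> (y - x0)) has_derivative (\<lambda>(h, k). p \<bullet> h + 0 * k))
      (at (x, t) within finite_dom (psi_time u 0 x0))"
    unfolding case_prod_beta by (auto intro!: derivative_eq_intros)
  then have "((\<lambda>(y, s). real_of_ereal (psi_time u 0 x0 y s)) has_derivative (\<lambda>(h, k). p \<bullet> h + 0 * k))
      (at (x, t) within finite_dom (psi_time u 0 x0))"
  proof (rule has_derivative_transform_within[OF _ zero_less_one fin])
    fix z assume z: "z \<in> finite_dom (psi_time u 0 x0)"
    obtain y s where ys: "z = (y, s)" by force
    show "(case z of (y, s) \<Rightarrow> p \<bullet> (y - x0)) = (case z of (y, s) \<Rightarrow> real_of_ereal (psi_time u 0 x0 y s))"
    proof (cases "y = x0")
      case True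
      then show ?thesis by (simp add: ys psi_time_def)
    next
      case False
      then show ?thesis
        using finite_dom_psi_time[OF z[unfolded ys] False] motion[of y] by (simp add: ys)
    qed
  qed
  moreover have "is_maximum (\<lambda>w. p \<bullet> (u + w) - time_cost x w) {w. norm w \<le> 0} 0"
    using u by (simp add: is_maximum_def time_cost_def p_def power2_norm_eq_inner)
  ultimately show ?thesis unfolding hjb_at_def by fastforce
qed

text \<open>
  The gradient \<open>p\<close> is a positive multiple of \<open>v\<close>, so by Cauchy-Schwarz no control of norm at most
  \<open>V = norm v\<close> does better than \<open>v\<close>; and \<open>p\<close> is normalized to make \<open>p \<bullet> (u + v) = 1\<close>.
\<close>

lemma hjb_time_at:
  fixes u :: "'a::euclidean_space"
  assumes fin: "(x, t) \<in> finite_dom (psi_time u V x0)" and ne: "x \<noteq> x0" and V: "0 \<le> V"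
    and disc: "0 < speed_disc u V (x - x0)"
  shows "hjb_at time_cost u V (psi_time u V x0) x t"
proof -
  define a where "a = x - x0"
  define S where "S = finite_dom (psi_time u V x0)"
  have a: "a \<noteq> 0" using ne by (simp add: a_def)
  obtain v where v: "max_speed_motion u V x0 x v" using finite_dom_psi_time(1)[OF fin ne] by blast
  have s: "0 < line_speed u V a" and veq: "v = (line_speed u V a / norm a) *\<^sub>R a - u"
    using v by (auto simp: max_speed_motion_iff[OF ne V] a_def)
  have nv: "norm v = V" using v by (simp add: max_speed_motion_def)
  define K where "K = v \<bullet> (v + u)"
  define p where "p = (1 / K) *\<^sub>R v"
  note der = max_speed_time_has_derivative[OF a disc[folded a_def] s V, folded veq, folded K_def]
  have K: "0 < K" using der(1) .
  have D: "((\<lambda>y. norm y / line_speed u V y) has_derivative (\<lambda>h. p \<bullet> h)) (at a)"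
    using der(2) by (simp add: p_def)
  have "((\<lambda>z. fst z - x0) has_derivative fst) (at (x, t) within S)"
    by (auto intro!: derivative_eq_intros)
  then have "((\<lambda>z. norm (fst z - x0) / line_speed u V (fst z - x0)) has_derivative (\<lambda>z. p \<bullet> fst z))
      (at (x, t) within S)"
    using has_derivative_compose[of "\<lambda>z. fst z - x0" fst "(x, t)" S] D by (simp add: a_def)
  moreover have "(\<lambda>z. p \<bullet> fst z) = (\<lambda>(h, k). p \<bullet> h + 0 * k)" by (auto simp: fun_eq_iff)
  ultimately have "((\<lambda>z. norm (fst z - x0) / line_speed u V (fst z - x0)) has_derivative
      (\<lambda>(h, k). p \<bullet> h + 0 * k)) (at (x, t) within S)" by simp
  then have "((\<lambda>(y, s). real_of_ereal (psi_time u V x0 y s)) has_derivative (\<lambda>(h, k). p \<bullet> h + 0 * k))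
      (at (x, t) within S)"
  (* within distance norm a of (x, t) the position x0, at which the value is given by a different
     clause, does not occur *)
  proof (rule has_derivative_transform_within)
    show "0 < norm a" using a by simp
    show "(x, t) \<in> S" using fin by (simp add: S_def)
    fix z assume z: "z \<in> S" "dist z (x, t) < norm a"
    obtain y s where ys: "z = (y, s)" by force
    have "y \<noteq> x0"
    proof
      assume "y = x0"
      then have "norm a = dist (fst z) (fst (x, t))" by (simp add: ys a_def dist_norm norm_minus_commute)
      then show False using z(2) dist_fst_le[of z "(x, t)"] by simp
    qed
    then show "norm (fst z - x0) / line_speed u V (fst z - x0) =
        (case z of (y, s) \<Rightarrow> real_of_ereal (psi_time u V x0 y s))"
      using finite_dom_psi_time(2)[of y s u V x0] z(1) by (simp add: ys S_def)
  qed
  moreover have "is_maximum (\<lambda>w. p \<bullet> (u + w) - time_cost x w) {w. norm w \<le> V} 0"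
    unfolding is_maximum_def
  proof (intro conjI ballI bexI[of _ v])
    have val: "p \<bullet> (u + w) - time_cost x w = (v \<bullet> w - v \<bullet> v) / K" for w :: 'a
    proof -
      have "p \<bullet> (u + w) - time_cost x w = (v \<bullet> (u + w) - K) / K"
        using K by (simp add: p_def time_cost_def diff_divide_distrib)
      then show ?thesis by (simp add: K_def inner_add_right)
    qed
    show "p \<bullet> (u + v) - time_cost x v = 0" by (simp add: val)
    show "v \<in> {w. norm w \<le> V}" using nv by simp
    fix w :: 'a assume "w \<in> {w. norm w \<le> V}"
    then have "norm v * norm w \<le> norm v * norm v" using nv by (intro mult_left_mono) auto
    then have "v \<bullet> w \<le> v \<bullet> v"
      using norm_cauchy_schwarz[of v w] by (simp add: power2_norm_eq_inner[symmetric] power2_eq_square)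
    then show "p \<bullet> (u + w) - time_cost x w \<le> 0"
      using K by (simp add: val divide_le_0_iff)
  qed
  ultimately show ?thesis unfolding hjb_at_def S_def by fastforce
qed

lemma hjb_solution_psi_time:
  fixes u :: "'a::euclidean_space"
  assumes V: "0 \<le> V"
  shows "hjb_solution time_cost u V (singular_positions u V x0) (psi_time u V x0)"
  unfolding hjb_solution_def
proof (intro allI impI, elim conjE)
  fix x t
  assume fin: "(x, t) \<in> finite_dom (psi_time u V x0)" and x: "x \<notin> singular_positions u V x0"
  have ne: "x \<noteq> x0" and fr: "x \<notin> frontier (reachable u V x0)"
    using x by (auto simp: singular_positions_def)
  show "hjb_at time_cost u V (psi_time u V x0) x t"
  proof (cases "V = 0")
    case True
    then show ?thesis using hjb_time_at_zero_speed fin ne by simp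
  next
    case False
    have "psi_time u V x0 x t \<noteq> \<infinity>" using fin by (auto simp: finite_dom_def)
    then have "x \<in> reachable u V x0"
      using induced_value_psi_time[OF V, of u x0]
      unfolding induced_value_def reachable_def by blast
    then have "x \<in> interior (reachable u V x0)"
      using fr closure_subset by (auto simp: frontier_def)
    then show ?thesis using hjb_time_at[OF fin ne V] speed_disc_pos[OF ne] V False by simp
  qed
qed

section \<open>The Hamilton-Jacobi-Bellman equation for the energy\<close>

lemma constant_control_admissible:
  fixes u :: "'a::euclidean_space"
  assumes "0 < T" "norm ((1 / T) *\<^sub>R (x - x0) - u) \<le> V"
  shows "admissible u V x0 x T (line_path u x0 ((1 / T) *\<^sub>R (x - x0) - u)) (\<lambda>_. (1 / T) *\<^sub>R (x - x0) - u)"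
  using assms by (intro line_path_admissible) auto

lemma induced_value_psi_energy:
  fixes u :: "'a::euclidean_space"
  shows "induced_value (energy_cost C) u V x0 (psi_energy u V C x0)"
  unfolding induced_value_def
proof (intro allI impI)
  fix x t assume "psi_energy u V C x0 x t \<noteq> \<infinity>"
  then have t: "0 < t" "norm ((1 / t) *\<^sub>R (x - x0) - u) \<le> V"
    and p: "psi_energy u V C x0 x t = ereal (((norm ((1 / t) *\<^sub>R (x - x0) - u))\<^sup>2 + C) * t)"
    by (auto simp: psi_energy_def Let_def split: if_splits)
  then show "\<exists>T y v. T \<le> t \<and> admissible u V x0 x T y v \<and>
      psi_energy u V C x0 x t = ereal (cost (energy_cost C) T y v)"
    using constant_control_admissible[OF t] cost_energy_line[of t C] by (metis less_le order_refl)
qed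

lemma energy_value_expand:
  fixes a u :: "'a::euclidean_space"
  assumes "t \<noteq> 0"
  shows "((norm ((1 / t) *\<^sub>R a - u))\<^sup>2 + C) * t = (a \<bullet> a) / t - 2 * (a \<bullet> u) + (C + u \<bullet> u) * t"
  unfolding power2_norm_eq_inner using assms
  by (simp add: inner_diff_left inner_diff_right inner_commute field_simps)

text \<open>
  With \<open>p = 2 *\<^sub>R v\<close> the expression to be maximized is a constant minus \<open>(norm (v - w))\<^sup>2\<close>; the maximizer
  \<open>w = v\<close> is allowed precisely because the value is finite.
\<close>

lemma hjb_solution_psi_energy:
  fixes u :: "'a::euclidean_space"
  shows "hjb_solution (energy_cost C) u V {} (psi_energy u V C x0)"
  unfolding hjb_solution_def
proof (intro allI impI, elim conjE)
  fix x t
  define S where "S = finite_dom (psi_energy u V C x0)"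
  assume "(x, t) \<in> finite_dom (psi_energy u V C x0)" and t: "0 < t"
  then have fin: "(x, t) \<in> S" by (simp add: S_def)
  define a where "a = x - x0"
  define v where "v = (1 / t) *\<^sub>R a - u"
  define q where "q = C + u \<bullet> u - (a \<bullet> a) / t\<^sup>2"
  have S: "0 < s \<and> norm ((1 / s) *\<^sub>R (y - x0) - u) \<le> V \<and>
      real_of_ereal (psi_energy u V C x0 y s) = ((y - x0) \<bullet> (y - x0)) / s - 2 * ((y - x0) \<bullet> u) + (C + u \<bullet> u) * s"
    if "(y, s) \<in> S" for y s
  proof -
    have "0 < s \<and> norm ((1 / s) *\<^sub>R (y - x0) - u) \<le> V"
      using that by (auto simp: S_def finite_dom_def psi_energy_def Let_def split: if_splits)
    then show ?thesis
      using energy_value_expand[of s "y - x0" u C] by (simp add: psi_energy_def Let_def)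
  qed
  have nv: "norm v \<le> V" using S[OF fin] by (simp add: v_def a_def)
  have "((\<lambda>z. ((fst z - x0) \<bullet> (fst z - x0)) / snd z - 2 * ((fst z - x0) \<bullet> u) + (C + u \<bullet> u) * snd z)
      has_derivative (\<lambda>z. (2 * (a \<bullet> fst z) * t - (a \<bullet> a) * snd z) / (t * t)
        - 2 * (fst z \<bullet> u) + (C + u \<bullet> u) * snd z)) (at (x, t) within S)"
    using t unfolding a_def by (auto intro!: derivative_eq_intros simp: fun_eq_iff inner_commute)
  moreover have "(\<lambda>z. (2 * (a \<bullet> fst z) * t - (a \<bullet> a) * snd z) / (t * t)
        - 2 * (fst z \<bullet> u) + (C + u \<bullet> u) * snd z) = (\<lambda>(h, k). (2 *\<^sub>R v) \<bullet> h + q * k)"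
    using t by (auto simp: fun_eq_iff v_def q_def inner_diff_left inner_diff_right inner_commute power2_eq_square field_simps)
  ultimately have "((\<lambda>z. ((fst z - x0) \<bullet> (fst z - x0)) / snd z - 2 * ((fst z - x0) \<bullet> u) + (C + u \<bullet> u) * snd z)
      has_derivative (\<lambda>(h, k). (2 *\<^sub>R v) \<bullet> h + q * k)) (at (x, t) within S)" by simp
  then have "((\<lambda>(y, s). real_of_ereal (psi_energy u V C x0 y s)) has_derivative
      (\<lambda>(h, k). (2 *\<^sub>R v) \<bullet> h + q * k)) (at (x, t) within S)"
  proof (rule has_derivative_transform_within[OF _ zero_less_one fin])
    fix z assume "z \<in> S"
    then show "((fst z - x0) \<bullet> (fst z - x0)) / snd z - 2 * ((fst z - x0) \<bullet> u) + (C + u \<bullet> u) * snd z =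
        (case z of (y, s) \<Rightarrow> real_of_ereal (psi_energy u V C x0 y s))"
      using S[of "fst z" "snd z"] by (simp add: case_prod_beta)
  qed
  moreover have "is_maximum (\<lambda>w. (2 *\<^sub>R v) \<bullet> (u + w) - energy_cost C x w) {w. norm w \<le> V} (- q)"
    unfolding is_maximum_def
  proof (intro conjI ballI bexI[of _ v])
    have av: "a = t *\<^sub>R (v + u)" using t by (simp add: v_def)
    have q: "q = C + u \<bullet> u - (v + u) \<bullet> (v + u)"
      unfolding q_def av using t by (simp add: power2_eq_square)
    have val: "(2 *\<^sub>R v) \<bullet> (u + w) - energy_cost C x w = - q - (norm (v - w))\<^sup>2" for w :: 'a
      unfolding q energy_cost_def power2_norm_eq_inner
      by (simp add: inner_diff_left inner_diff_right inner_add_left inner_add_right inner_commute)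
    show "(2 *\<^sub>R v) \<bullet> (u + v) - energy_cost C x v = - q" unfolding val by simp
    show "v \<in> {w. norm w \<le> V}" using nv by simp
    fix w :: 'a
    show "(2 *\<^sub>R v) \<bullet> (u + w) - energy_cost C x w \<le> - q" unfolding val by simp
  qed
  ultimately show "hjb_at (energy_cost C) u V (psi_energy u V C x0) x t"
    unfolding hjb_at_def S_def by fastforce
qed

section \<open>The minimum energy motion\<close>

text \<open>
  The ground speed that is cheapest when the bound \<open>V\<close> is ignored; \<open>t_star\<close> is the travel time at this
  speed.
\<close>

definition cruise_speed :: "'a::euclidean_space \<Rightarrow> real \<Rightarrow> real" where
  "cruise_speed u C = sqrt ((norm u)\<^sup>2 + C)"

lemma energy_value_speed:
  fixes a u :: "'a::euclidean_space"
  assumes "a \<noteq> 0" "T \<noteq> 0" "0 \<le> C"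
  shows "((norm ((1 / T) *\<^sub>R a - u))\<^sup>2 + C) * T =
    norm a * (norm a / T + (cruise_speed u C)\<^sup>2 / (norm a / T)) - 2 * (a \<bullet> u)"
  using assms unfolding energy_value_expand[OF assms(2)]
  by (simp add: cruise_speed_def power2_norm_eq_inner[symmetric] power2_eq_square field_simps)

text \<open>
  The function \<open>s + w\<^sup>2 / s\<close> decreases on \<open>(0, w]\<close> and has its global minimum at \<open>w\<close>: the two alternatives
  are the saturated and the unsaturated case.
\<close>

lemma energy_value_mono:
  fixes w s s' :: real
  assumes "0 < s" "0 < s'" "s' \<le> s \<and> s \<le> w \<or> s = w"
  shows "s + w\<^sup>2 / s \<le> s' + w\<^sup>2 / s'"
proof -
  have "0 \<le> (s - s') * (w\<^sup>2 - s * s')"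
  proof (cases "s = w")
    case True
    then have "(s - s') * (w\<^sup>2 - s * s') = s * (s - s')\<^sup>2"
      by (simp add: power2_eq_square algebra_simps)
    then show ?thesis using assms by simp
  next
    case False
    then have "s * s' \<le> w * w" using assms by (intro mult_mono) auto
    then show ?thesis using assms False by (simp add: power2_eq_square)
  qed
  moreover have "(s' + w\<^sup>2 / s') - (s + w\<^sup>2 / s) = (s - s') * (w\<^sup>2 - s * s') / (s * s')"
    using assms by (simp add: field_simps power2_eq_square)
  ultimately have "0 \<le> (s' + w\<^sup>2 / s') - (s + w\<^sup>2 / s)" using assms by simp
  then show ?thesis by simp
qed

lemma unsaturated_iff:
  fixes a u :: "'a::euclidean_space"
  assumes "a \<noteq> 0" "0 \<le> C" "0 < (norm u)\<^sup>2 + C"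
  shows "0 < t_star u C a" "norm a / t_star u C a = cruise_speed u C"
    "unsaturated u V C a \<longleftrightarrow> (cruise_speed u C - along u a)\<^sup>2 \<le> speed_disc u V a"
    "(norm ((1 / t_star u C a) *\<^sub>R a - u))\<^sup>2 =
       C + 2 * (norm u)\<^sup>2 - sqrt (C + (norm u)\<^sup>2) * (2 * (a \<bullet> u) / norm a)"
proof -
  have w: "0 < cruise_speed u C" using assms by (simp add: cruise_speed_def)
  show t: "0 < t_star u C a" using assms by (simp add: t_star_def)
  show at: "norm a / t_star u C a = cruise_speed u C"
    using assms by (simp add: t_star_def cruise_speed_def)
  have e1: "(norm a)\<^sup>2 / (t_star u C a)\<^sup>2 = (cruise_speed u C)\<^sup>2"
    by (simp add: at[symmetric] power_divide)
  have e2: "2 * (a \<bullet> u) / t_star u C a = 2 * cruise_speed u C * along u a"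
    using assms(1) by (simp add: at[symmetric] along_def)
  show "unsaturated u V C a \<longleftrightarrow> (cruise_speed u C - along u a)\<^sup>2 \<le> speed_disc u V a"
    unfolding unsaturated_def e1 e2 by (auto simp: speed_disc_def power2_diff)
  have "(cruise_speed u C)\<^sup>2 = C + (norm u)\<^sup>2" using assms by (simp add: cruise_speed_def)
  then show "(norm ((1 / t_star u C a) *\<^sub>R a - u))\<^sup>2 =
       C + 2 * (norm u)\<^sup>2 - sqrt (C + (norm u)\<^sup>2) * (2 * (a \<bullet> u) / norm a)"
    using control_norm_identity[OF assms(1), of "t_star u C a" u V] t
    by (simp add: at speed_disc_def power2_diff cruise_speed_def along_def add.commute)
qed

lemma sqrt_disc_scaled:
  fixes a u :: "'a::euclidean_space"
  assumes "a \<noteq> 0"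
  shows "sqrt ((a \<bullet> u)\<^sup>2 + (norm a)\<^sup>2 * (V\<^sup>2 - (norm u)\<^sup>2)) = norm a * sqrt (speed_disc u V a)"
proof -
  have "(a \<bullet> u)\<^sup>2 + (norm a)\<^sup>2 * (V\<^sup>2 - (norm u)\<^sup>2) = (norm a)\<^sup>2 * speed_disc u V a"
    using assms by (simp add: speed_disc_def along_def power_divide field_simps)
  then show ?thesis by (simp add: real_sqrt_mult)
qed

text \<open>
  The numerator and the denominator of the saturated travel time share the factor
  \<open>along u a - sqrt speed_disc\<close>, the smaller root; after cancelling it, the larger root \<open>line_speed\<close>
  remains.
\<close>

lemma saturated_time:
  fixes a u :: "'a::euclidean_space"
  assumes "a \<noteq> 0" "0 \<le> V" "norm u \<noteq> V" "0 \<le> speed_disc u V a" "line_speed u V a \<noteq> 0"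
  shows "1 / ((norm u)\<^sup>2 - V\<^sup>2) *
           (a \<bullet> u - sqrt ((a \<bullet> u)\<^sup>2 + (norm a)\<^sup>2 * (V\<^sup>2 - (norm u)\<^sup>2))) = norm a / line_speed u V a"
proof -
  have k: "(norm u)\<^sup>2 - V\<^sup>2 \<noteq> 0" using assms by (simp add: power2_eq_iff_nonneg)
  have e1: "(norm u)\<^sup>2 - V\<^sup>2 = (along u a - sqrt (speed_disc u V a)) * line_speed u V a"
    using assms(4) by (simp add: line_speed_eq algebra_simps power2_eq_square[symmetric])
      (simp add: speed_disc_def)
  have e2: "a \<bullet> u - sqrt ((a \<bullet> u)\<^sup>2 + (norm a)\<^sup>2 * (V\<^sup>2 - (norm u)\<^sup>2)) =
      norm a * (along u a - sqrt (speed_disc u V a))"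
    unfolding sqrt_disc_scaled[OF assms(1)] using assms(1) by (simp add: along_def right_diff_distrib)
  have "along u a - sqrt (speed_disc u V a) \<noteq> 0" using k e1 by auto
  then show ?thesis unfolding e2 e1 using assms(5) by simp
qed

text \<open>
  In the saturated case the maximum speed motion is the energy motion.
\<close>

lemma energy_motion_exists:
  fixes u :: "'a::euclidean_space"
  assumes ne: "x \<noteq> x0" and V: "0 \<le> V" and C: "0 \<le> C" "0 < (norm u)\<^sup>2 + C"
    and reach: "x \<in> reachable u V x0"
  shows "\<exists>v T. energy_motion u V C x0 x v T"
proof -
  define a where "a = x - x0"
  have a: "a \<noteq> 0" using ne by (simp add: a_def)
  note us = unsaturated_iff[OF a C]
  show ?thesis
  proof (cases "unsaturated u V C a")
    case True
    have "norm ((1 / t_star u C a) *\<^sub>R a - u) = energy_speed u V C a"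
      using True us(4) by (simp add: energy_speed_def) (metis abs_norm_cancel real_sqrt_abs)
    then have "energy_motion u V C x0 x ((1 / t_star u C a) *\<^sub>R a - u) (t_star u C a)"
      using True us(1) by (simp add: energy_motion_def energy_time_def a_def)
    then show ?thesis by blast
  next
    case False
    define s where "s = line_speed u V a"
    obtain v where v: "max_speed_motion u V x0 x v"
      using max_speed_motion_exists[OF ne V reach] by blast
    have d: "0 \<le> speed_disc u V a" and s: "0 < s" and veq: "v = (s / norm a) *\<^sub>R a - u"
      using v by (auto simp: max_speed_motion_iff[OF ne V] a_def s_def)
    have "norm v = V" using v by (simp add: max_speed_motion_def)
    moreover have "v = (1 / (norm a / s)) *\<^sub>R a - u" by (simp add: veq)
    moreover have "norm u \<noteq> V \<longrightarrow> norm a / s = energy_time u V C a"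
      using False saturated_time[OF a V _ d] s by (simp add: energy_time_def s_def)
    ultimately have "energy_motion u V C x0 x v (norm a / s)"
      using False s a by (simp add: energy_motion_def energy_speed_def a_def[symmetric])
    then show ?thesis by blast
  qed
qed

text \<open>
  In the saturated case \<open>norm v = V\<close> makes \<open>s = norm a / T\<close> an end point of the interval of admissible
  speeds.  It is the right one: with \<open>k = (norm u)\<^sup>2 - V\<^sup>2\<close> the product of both end points, the left
  one is not positive if \<open>k \<le> 0\<close>, and the formula for \<open>T\<close> excludes it if \<open>k > 0\<close>.  If now the cruising
  speed \<open>w\<close>, which is outside the interval, were not above it, it would be below it, so the
  product \<open>k\<close> of the end points would exceed \<open>w\<^sup>2\<close>; but \<open>k \<le> (norm u)\<^sup>2 + C = w\<^sup>2\<close>.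
\<close>

lemma energy_motion_speed:
  fixes u :: "'a::euclidean_space"
  assumes ne: "x \<noteq> x0" and V: "0 \<le> V" and C: "0 \<le> C" "0 < (norm u)\<^sup>2 + C"
    and mot: "energy_motion u V C x0 x v T"
  defines "a \<equiv> x - x0"
  shows "norm v \<le> V"
    and "norm a / T = (if unsaturated u V C a then cruise_speed u C else line_speed u V a)"
    and "\<not> unsaturated u V C a \<Longrightarrow> norm a / T < cruise_speed u C"
proof -
  define s where "s = norm a / T"
  define c where "c = along u a"
  define d where "d = speed_disc u V a"
  define k where "k = (norm u)\<^sup>2 - V\<^sup>2"
  define w where "w = cruise_speed u C"
  have a: "a \<noteq> 0" using ne by (simp add: a_def)
  have T: "0 < T" and veq: "v = (1 / T) *\<^sub>R a - u" and nv: "norm v = energy_speed u V C a"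
    and time: "unsaturated u V C a \<or> norm u \<noteq> V \<longrightarrow> T = energy_time u V C a"
    using mot by (auto simp: energy_motion_def a_def)
  note us = unsaturated_iff[OF a C]
  have s: "0 < s" using a T by (simp add: s_def)
  have w: "0 < w" "k \<le> w\<^sup>2" using C by (simp_all add: w_def k_def cruise_speed_def add_increasing2)
  have dk: "d = c\<^sup>2 - k" by (simp add: d_def c_def k_def speed_disc_def)
  have sat: "s = c + sqrt d \<and> s < w \<and> norm v = V" if ns: "\<not> unsaturated u V C a"
  proof -
    have nvV: "norm v = V" using nv ns by (simp add: energy_speed_def)
    then have root: "(s - c)\<^sup>2 = d"
      using control_norm_eq_iff[OF a, of T V u] T V veq by (simp add: s_def c_def d_def)
    have d0: "0 \<le> d" using root zero_le_power2[of "s - c"] by linarith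
    have quad: "s * s = 2 * s * c - k" using root dk by (simp add: power2_eq_square algebra_simps)
    have ge: "c \<le> s"
    proof (cases "k \<le> 0")
      case True
      have "0 \<le> s * (s - 2 * c)" using quad True by (simp add: algebra_simps)
      then have "2 * c \<le> s" using s by (simp add: zero_le_mult_iff)
      then show ?thesis using s by linarith
    next
      case False
      then have "norm u \<noteq> V" by (auto simp: k_def)
      then have "T = 1 / k * (a \<bullet> u - norm a * sqrt d)"
        using time ns by (simp add: energy_time_def sqrt_disc_scaled[OF a] k_def d_def)
      then have "k * T = a \<bullet> u - norm a * sqrt d" using False by simp
      also have "\<dots> \<le> norm a * c" using a d0 by (simp add: c_def along_def)
      finally have "k \<le> s * c" using T by (simp add: s_def field_simps)
      then have "s * c \<le> s * s" using quad by (simp add: algebra_simps)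
      then show ?thesis using s by simp
    qed
    have "sqrt d = s - c" using root ge by (metis abs_of_nonneg diff_ge_0_iff_ge real_sqrt_abs)
    moreover have "s < w"
    proof (rule ccontr)
      assume "\<not> s < w"
      then have ws: "w \<le> s" by simp
      have "(s - c)\<^sup>2 < (w - c)\<^sup>2" using ns us(3) root by (simp add: w_def c_def d_def)
      then have "0 < (s - w) * (2 * c - s - w)" by (simp add: power2_eq_square algebra_simps)
      then have "w < 2 * c - s" using ws by (auto simp: zero_less_mult_iff)
      then have "s * w < s * (2 * c - s)" using s by simp
      also have "\<dots> = k" using quad by (simp add: algebra_simps)
      also have "k \<le> w * w" using w by (simp add: power2_eq_square)
      finally show False using ws w by (simp add: mult_less_cancel_right)
    qed
    ultimately show ?thesis using nvV by simp
  qed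
  have unsat: "T = t_star u C a" if "unsaturated u V C a"
    using time that by (simp add: energy_time_def)
  show "norm v \<le> V"
  proof (cases "unsaturated u V C a")
    case True
    then show ?thesis
      using unsat us control_norm_le_iff[OF a, of T V u] T V veq by simp
  qed (use sat in auto)
  show "norm a / T = (if unsaturated u V C a then cruise_speed u C else line_speed u V a)"
    using unsat us(2) sat by (auto simp: line_speed_eq s_def c_def d_def)
  show "norm a / T < cruise_speed u C" if "\<not> unsaturated u V C a"
    using sat[OF that] by (simp add: s_def w_def)
qed

text \<open>
  A competitor is first replaced by the straight motion with the same duration, whose ground speed \<open>s'\<close>
  is at most \<open>line_speed\<close>; then only the one-variable function \<open>s + w\<^sup>2 / s\<close> has to be compared.
\<close>

lemma optimal_energy:
  fixes u :: "'a::euclidean_space"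
  assumes ne: "x \<noteq> x0" and V: "0 \<le> V" and C: "0 \<le> C" "0 < (norm u)\<^sup>2 + C"
    and mot: "energy_motion u V C x0 x v T"
  shows "optimal u V x0 x (energy_cost C) T (line_path u x0 v) (\<lambda>_. v)"
proof -
  define a where "a = x - x0"
  note sp = energy_motion_speed[OF ne V C mot, folded a_def]
  have a: "a \<noteq> 0" using ne by (simp add: a_def)
  have T: "0 < T" and veq: "v = (1 / T) *\<^sub>R a - u"
    using mot by (auto simp: energy_motion_def a_def)
  have "admissible u V x0 x T (line_path u x0 v) (\<lambda>_. v)"
    using constant_control_admissible[OF T, of x x0 u V] sp(1) veq by (simp add: a_def)
  moreover have "cost (energy_cost C) T (line_path u x0 v) (\<lambda>_. v) \<le> cost (energy_cost C) T' x' v'"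
    if adm: "admissible u V x0 x T' x' v'" for T' x' v'
  proof -
    note mc = admissible_mean_control[OF adm V ne, folded a_def]
    define s where "s = norm a / T"
    define s' where "s' = norm a / T'"
    have pos: "0 < s" "0 < s'" using a T mc(1) by (simp_all add: s_def s'_def)
    have "s' \<le> line_speed u V a"
      using line_speed_ge(2)[OF a, of T' V u] mc V by (simp add: s'_def)
    then have "s + (cruise_speed u C)\<^sup>2 / s \<le> s' + (cruise_speed u C)\<^sup>2 / s'"
      using sp(2,3) by (intro energy_value_mono pos) (auto simp: s_def)
    then have "norm a * (s + (cruise_speed u C)\<^sup>2 / s) \<le> norm a * (s' + (cruise_speed u C)\<^sup>2 / s')"
      by (intro mult_left_mono) auto
    then have "((norm v)\<^sup>2 + C) * T \<le> ((norm ((1 / T') *\<^sub>R a - u))\<^sup>2 + C) * T'"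
      unfolding veq using energy_value_speed[OF a _ C(1), of T u] energy_value_speed[OF a _ C(1), of T' u]
        T mc(1) by (simp add: s_def s'_def)
    then show ?thesis
      using cost_energy_ge[OF adm V ne, of C] T by (simp add: a_def cost_energy_line)
  qed
  ultimately show ?thesis by (auto simp: optimal_def)
qed

section \<open>Optimality of both motions\<close>

theorem theorem4p4:
  fixes u x0 xf :: "real ^ 'd" and V C :: real
  assumes "0 \<le> V" and "0 \<le> C" and "x0 \<noteq> xf"
  shows
    "(induced_value time_cost u V x0 (psi_time u V x0) \<and>
     hjb_solution time_cost u V (singular_positions u V x0) (psi_time u V x0) \<and>
     (xf \<in> reachable u V x0 \<longrightarrow> (\<exists>v. max_speed_motion u V x0 xf v)) \<and>
     (\<forall>v T. max_speed_motion u V x0 xf v \<and> T = norm (xf - x0) / norm (v + u) \<longrightarrow>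
        psi_time u V x0 xf T = ereal (cost time_cost T (line_path u x0 v) (\<lambda>_. v)) \<and>
        (\<forall>\<phi> t. induced_value time_cost u V x0 \<phi> \<and>
               hjb_solution time_cost u V (singular_positions u V x0) \<phi> \<longrightarrow>
               ereal (cost time_cost T (line_path u x0 v) (\<lambda>_. v)) \<le> \<phi> xf t) \<and>
        optimal u V x0 xf time_cost T (line_path u x0 v) (\<lambda>_. v))) \<and>
     (induced_value (energy_cost C) u V x0 (psi_energy u V C x0) \<and>
     hjb_solution (energy_cost C) u V {} (psi_energy u V C x0) \<and>
     (0 < (norm u)\<^sup>2 + C \<longrightarrow>
       (xf \<in> reachable u V x0 \<longrightarrow> (\<exists>v T. energy_motion u V C x0 xf v T)) \<and>
       (\<forall>v T. energy_motion u V C x0 xf v T \<longrightarrow>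
          psi_energy u V C x0 xf T = ereal (cost (energy_cost C) T (line_path u x0 v) (\<lambda>_. v)) \<and>
          (\<forall>\<phi> t. induced_value (energy_cost C) u V x0 \<phi> \<and>
                 hjb_solution (energy_cost C) u V (singular_positions u V x0) \<phi> \<longrightarrow>
                 ereal (cost (energy_cost C) T (line_path u x0 v) (\<lambda>_. v)) \<le> \<phi> xf t) \<and>
          optimal u V x0 xf (energy_cost C) T (line_path u x0 v) (\<lambda>_. v))))"
proof -
  have ne: "xf \<noteq> x0" using assms(3) by simp
  note V = assms(1) and C = assms(2)
  have time: "psi_time u V x0 xf T = ereal (cost time_cost T (line_path u x0 v) (\<lambda>_. v)) \<and>
      optimal u V x0 xf time_cost T (line_path u x0 v) (\<lambda>_. v)"
    if v: "max_speed_motion u V x0 xf v" and Teq: "T = norm (xf - x0) / norm (v + u)" for v T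
  proof -
    have T: "T = norm (xf - x0) / line_speed u V (xf - x0)"
      using v Teq by (simp add: max_speed_motion_def)
    have "0 \<le> T" using Teq by simp
    then have "psi_time u V x0 xf T = ereal (cost time_cost T (line_path u x0 v) (\<lambda>_. v))"
      using v ne by (auto simp: psi_time_def cost_time_eq T)
    then show ?thesis using optimal_time[OF ne V v] T by simp
  qed
  have energy: "psi_energy u V C x0 xf T = ereal (cost (energy_cost C) T (line_path u x0 v) (\<lambda>_. v)) \<and>
      optimal u V x0 xf (energy_cost C) T (line_path u x0 v) (\<lambda>_. v)"
    if w: "0 < (norm u)\<^sup>2 + C" and mot: "energy_motion u V C x0 xf v T" for v T
  proof -
    have "0 < T" "v = (1 / T) *\<^sub>R (xf - x0) - u" using mot by (auto simp: energy_motion_def)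
    moreover have "norm v \<le> V" using energy_motion_speed(1)[OF ne V C w mot] .
    ultimately have "psi_energy u V C x0 xf T = ereal (cost (energy_cost C) T (line_path u x0 v) (\<lambda>_. v))"
      by (simp add: psi_energy_def Let_def cost_energy_line)
    then show ?thesis using optimal_energy[OF ne V C w mot] by simp
  qed
  note least_time = optimal_le_induced_value[OF conjunct2[OF time]]
  note least_energy = optimal_le_induced_value[OF conjunct2[OF energy]]
  show ?thesis
    by (intro conjI allI impI; (elim conjE)?)
      (simp_all add: time energy least_time least_energy induced_value_psi_time[OF V]
        hjb_solution_psi_time[OF V] induced_value_psi_energy hjb_solution_psi_energy
        max_speed_motion_exists[OF ne V] energy_motion_exists[OF ne V C])
qed

end
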